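(* Let $\beta(y)\neq 1$ on $(a,b)$ and suppose that $\Delta_n\neq 0$ for all $n\ge 0$, where $\Delta_n$ is the $(n+1)\times(n+1)$ determinant $$\Delta_n=\begin{vmatrix} 1 & \mathcal{L}_{\omega}[y] & \cdots & \mathcal{L}_{\omega}[y^{n}]\\ \mathcal{L}_{(\beta-1)\omega}[1] & \mathcal{L}_{(\beta-1)\omega}[y] & \cdots & \mathcal{L}_{(\beta-1)\omega}[y^{n}]\\ \vdots & \vdots & \ddots & \vdots\\ \mathcal{L}_{(\beta-1)\omega}[\beta^{n-1}] & \mathcal{L}_{(\beta-1)\omega}[y\beta^{n-1}] & \cdots & \mathcal{L}_{(\beta-1)\omega}[y^{n}\beta^{n-1}] \end{vmatrix}$$ (the first row has entries $\mathcal{L}_\omega[y^j]$, $0\le j\le n$, and the row after it indexed by $i=0,\dots,n-1$ has entries $\mathcal{L}_{(\beta-1)\omega}[y^j\beta^i]$, $0\le j\le n$). If the sequence $(P_n)_{n\ge 0}$ is defined by $$P_n(x)=\frac{1}{\Delta_n}\begin{vmatrix} 1 & x & \cdots & x^{n}\\ \mathcal{L}_{(\beta-1)\omega}[1] & \mathcal{L}_{(\beta-1)\omega}[y] & \cdots & \mathcal{L}_{(\beta-1)\omega}[y^{n}]\\ \vdots & \vdots & \ddots & \vdots\\ \mathcal{L}_{(\beta-1)\omega}[\beta^{n-1}] & \mathcal{L}_{(\beta-1)\omega}[y\beta^{n-1}] & \cdots & \mathcal{L}_{(\beta-1)\omega}[y^{n}\beta^{n-1}] \end{vmatrix},$$ then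 $$\int_a^b P_n(y)\,P_n[\beta(y)x]\,\omega(y)\,dy=P_n(x)$$ for all $n$ (as an identity in $x$).
   Context: $(a,b)$ is an interval (possibly unbounded) of the real line. $\omega(y)$ is a non-negative integrable function on $(a,b)$ with $\int_a^b\omega(y)\,dy=1$. $\beta(y)$ is an integrable function on $(a,b)$. For a weight function $w$ on $(a,b)$, $\mathcal{L}_w$ denotes the linear functional $\mathcal{L}_w[f]=\int_a^b f(y)w(y)\,dy$; thus $\mathcal{L}_{(\beta-1)\omega}[f]=\int_a^b f(y)(\beta(y)-1)\omega(y)\,dy$, and inside the functional $y$ denotes the integration variable and $\beta=\beta(y)$. All integrals appearing as entries of the determinants are assumed to converge (absolutely). $P_n[\beta(y)x]$ denotes the polynomial $P_n$ evaluated at $\beta(y)x$. For $n=0$ both determinants consist of the single entry $1$. *)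

theory Defs
  imports "HOL-Analysis.Analysis" "Jordan_Normal_Form.Determinant"
begin

definition lin_fun :: "ereal \<Rightarrow> ereal \<Rightarrow> (real \<Rightarrow> real) \<Rightarrow> (real \<Rightarrow> real) \<Rightarrow> real" where
  "lin_fun a b w f = (LINT y=a..b|lebesgue. (f y * w y))"

text \<open>Row \<open>0\<close> is the special first row; row \<open>Suc i\<close> is the row indexed by \<open>i\<close> with entries
  \<open>\<L>\<^bsub>(\<beta> - 1)\<omega>\<^esub>[y\<^sup>j \<beta>\<^sup>i]\<close>. Since both HOL-Analysis and Jordan_Normal_Form provide constants
  \<open>mat\<close> and \<open>det\<close>, these names are qualified; so are
  \<open>monom\<close> and \<open>smult\<close>, which also exist in HOL-Algebra.\<close>

definition Delta_mat ::
  "ereal \<Rightarrow> ereal \<Rightarrow> (real \<Rightarrow> real) \<Rightarrow> (real \<Rightarrow> real) \<Rightarrow> nat \<Rightarrow> real Matrix.mat" where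
  "Delta_mat a b \<omega> \<beta> n = Matrix.mat (n + 1) (n + 1) (\<lambda>(r, j).
     case r of
       0 \<Rightarrow> lin_fun a b \<omega> (\<lambda>y. y ^ j)
     | Suc i \<Rightarrow> lin_fun a b (\<lambda>y. (\<beta> y - 1) * \<omega> y) (\<lambda>y. y ^ j * \<beta> y ^ i))"

definition Delta :: "ereal \<Rightarrow> ereal \<Rightarrow> (real \<Rightarrow> real) \<Rightarrow> (real \<Rightarrow> real) \<Rightarrow> nat \<Rightarrow> real" where
  "Delta a b \<omega> \<beta> n = Determinant.det (Delta_mat a b \<omega> \<beta> n)"

text \<open>The first row now consists of the powers of the indeterminate, so the matrix has
  polynomial entries and its other entries are constant polynomials.\<close>

definition P_mat ::
  "ereal \<Rightarrow> ereal \<Rightarrow> (real \<Rightarrow> real) \<Rightarrow> (real \<Rightarrow> real) \<Rightarrow> nat \<Rightarrow> real poly Matrix.mat" where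
  "P_mat a b \<omega> \<beta> n = Matrix.mat (n + 1) (n + 1) (\<lambda>(r, j).
     case r of
       0 \<Rightarrow> Polynomial.monom 1 j
     | Suc i \<Rightarrow> [:lin_fun a b (\<lambda>y. (\<beta> y - 1) * \<omega> y) (\<lambda>y. y ^ j * \<beta> y ^ i):])"

definition P :: "ereal \<Rightarrow> ereal \<Rightarrow> (real \<Rightarrow> real) \<Rightarrow> (real \<Rightarrow> real) \<Rightarrow> nat \<Rightarrow> real poly" where
  "P a b \<omega> \<beta> n = Polynomial.smult (1 / Delta a b \<omega> \<beta> n) (Determinant.det (P_mat a b \<omega> \<beta> n))"

end

theory Submission imports Defs begin

text \<open>Expanding the determinant of \<open>P\<^sub>n\<close> along its first row shows that a linear functional applied
  to \<open>P\<^sub>n\<close> replaces that row by the moments of the functional. Hence \<open>\<L>\<^sub>\<omega>[P\<^sub>n] = 1\<close>, while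
  \<open>\<L>\<^bsub>(\<beta> - 1)\<omega>\<^esub>[P\<^sub>n \<beta>\<^sup>i] = 0\<close> for \<open>i < n\<close> because two rows coincide. The latter says that
  \<open>\<L>\<^sub>\<omega>[P\<^sub>n \<beta>\<^sup>k]\<close> does not change when \<open>k \<le> n\<close> varies, so it always equals \<open>1\<close>; expanding
  \<open>P\<^sub>n(\<beta>(y)x)\<close> in powers of \<open>x\<close> then reproduces \<open>P\<^sub>n(x)\<close>.\<close>

text \<open>The common shape of \<open>Delta_mat\<close> and \<open>P_mat\<close>; the entry type
  stays open so that real and polynomial entries are both covered.\<close>

definition bordered_mat :: "nat \<Rightarrow> (nat \<Rightarrow> nat \<Rightarrow> 'a) \<Rightarrow> (nat \<Rightarrow> 'a) \<Rightarrow> 'a Matrix.mat" where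
  "bordered_mat n M v = Matrix.mat (Suc n) (Suc n) (\<lambda>(r, j). case r of 0 \<Rightarrow> v j | Suc i \<Rightarrow> M i j)"

text \<open>Deleting row 0 discards the border, so the zero row is only a placeholder.\<close>

definition border_cofactor :: "nat \<Rightarrow> (nat \<Rightarrow> nat \<Rightarrow> 'a::comm_ring_1) \<Rightarrow> nat \<Rightarrow> 'a" where
  "border_cofactor n M = cofactor (bordered_mat n M (\<lambda>_. 0)) 0"

lemma bordered_mat_carrier [simp]: "bordered_mat n M v \<in> carrier_mat (Suc n) (Suc n)"
  by (simp add: bordered_mat_def)

lemma cofactor_bordered_mat: "cofactor (bordered_mat n M v) 0 j = border_cofactor n M j"
proof -
  have "mat_delete (bordered_mat n M v) 0 j = mat_delete (bordered_mat n M (\<lambda>_. 0)) 0 j"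
    by (rule eq_matI) (auto simp: mat_delete_def bordered_mat_def)
  then show ?thesis
    by (simp add: border_cofactor_def cofactor_def)
qed

text \<open>Laplace expansion along row 0. The cofactors do not involve \<open>v\<close>, so one
  family of coefficients serves every border.\<close>

lemma det_bordered_mat:
  "Determinant.det (bordered_mat n M v) = (\<Sum>j\<le>n. v j * border_cofactor n M j)"
proof -
  have "Determinant.det (bordered_mat n M v)
      = (\<Sum>j<Suc n. bordered_mat n M v $$ (0, j) * cofactor (bordered_mat n M v) 0 j)"
    by (rule laplace_expansion_row) auto
  also have "\<dots> = (\<Sum>j<Suc n. v j * border_cofactor n M j)"
    by (intro sum.cong) (simp_all only: cofactor_bordered_mat, simp_all add: bordered_mat_def)
  finally show ?thesis
    by (simp add: lessThan_Suc_atMost)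
qed

lemma det_bordered_mat_repeated_row:
  assumes "i < n"
  shows "Determinant.det (bordered_mat n M (M i)) = 0"
proof (rule det_identical_rows[of _ "Suc n" 0 "Suc i"])
  show "row (bordered_mat n M (M i)) 0 = row (bordered_mat n M (M i)) (Suc i)"
    using assms by (intro eq_vecI) (auto simp: bordered_mat_def)
qed (use assms in auto)

text \<open>Cofactors arise from the entries by ring operations. For the embedding of constants into
  polynomials this makes the row 0 cofactors of \<open>P_mat\<close> constant, hence coefficients of
  the expanded determinant.\<close>

lemma (in comm_ring_hom) hom_border_cofactor:
  "border_cofactor n (\<lambda>i j. hom (M i j)) j = hom (border_cofactor n M j)"
proof -
  have "mat_delete (bordered_mat n (\<lambda>i j. hom (M i j)) (\<lambda>_. 0)) 0 j
      = map_mat hom (mat_delete (bordered_mat n M (\<lambda>_. 0)) 0 j)"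
    by (rule eq_matI) (auto simp: mat_delete_def bordered_mat_def)
  then show ?thesis
    by (simp add: border_cofactor_def cofactor_def hom_distribs)
qed

lemma comm_ring_hom_const_poly: "comm_ring_hom (\<lambda>c::'a::comm_ring_1. [:c:])"
  by unfold_locales (auto simp: one_pCons)

context
  fixes a b :: ereal and \<omega> \<beta> :: "real \<Rightarrow> real"
begin

abbreviation weighted_moment :: "nat \<Rightarrow> nat \<Rightarrow> real" where
  "weighted_moment i j \<equiv> lin_fun a b (\<lambda>y. (\<beta> y - 1) * \<omega> y) (\<lambda>y. y ^ j * \<beta> y ^ i)"

abbreviation P_coeff :: "nat \<Rightarrow> nat \<Rightarrow> real" where
  "P_coeff n j \<equiv> border_cofactor n weighted_moment j / Delta a b \<omega> \<beta> n"

lemma Delta_expansion: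
  "Delta a b \<omega> \<beta> n = (\<Sum>j\<le>n. lin_fun a b \<omega> (\<lambda>y. y ^ j) * border_cofactor n weighted_moment j)"
proof -
  have "Delta_mat a b \<omega> \<beta> n = bordered_mat n weighted_moment (\<lambda>j. lin_fun a b \<omega> (\<lambda>y. y ^ j))"
    by (simp add: Delta_mat_def bordered_mat_def)
  then show ?thesis
    by (simp add: Delta_def det_bordered_mat)
qed

lemma poly_P: "poly (P a b \<omega> \<beta> n) x = (\<Sum>j\<le>n. P_coeff n j * x ^ j)"
proof -
  interpret const: comm_ring_hom "\<lambda>c::real. [:c:]"
    by (rule comm_ring_hom_const_poly)
  have "P_mat a b \<omega> \<beta> n
      = bordered_mat n (\<lambda>i j. [:weighted_moment i j:]) (\<lambda>j. Polynomial.monom 1 j)"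
    by (simp add: P_mat_def bordered_mat_def)
  then have "Determinant.det (P_mat a b \<omega> \<beta> n)
      = (\<Sum>j\<le>n. Polynomial.monom 1 j * [:border_cofactor n weighted_moment j:])"
    by (simp only: det_bordered_mat const.hom_border_cofactor)
  then show ?thesis
    by (simp add: P_def poly_sum poly_monom sum_distrib_left sum_divide_distrib mult.commute)
qed

lemma P_coeff_sum_moments:
  assumes "Delta a b \<omega> \<beta> n \<noteq> 0"
  shows "(\<Sum>j\<le>n. P_coeff n j * lin_fun a b \<omega> (\<lambda>y. y ^ j)) = 1"
proof -
  have "(\<Sum>j\<le>n. P_coeff n j * lin_fun a b \<omega> (\<lambda>y. y ^ j)) = Delta a b \<omega> \<beta> n / Delta a b \<omega> \<beta> n"
    \<comment> \<open>Only the numerator is expanded; the denominator must keep matching the one in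
      \<open>P_coeff\<close>.\<close>
    by (subst (2) Delta_expansion) (simp add: sum_divide_distrib mult.commute)
  then show ?thesis
    using assms by simp
qed

lemma P_coeff_sum_weighted_moments:
  assumes "i < n"
  shows "(\<Sum>j\<le>n. P_coeff n j * weighted_moment i j) = 0"
proof -
  have "(\<Sum>j\<le>n. P_coeff n j * weighted_moment i j)
      = Determinant.det (bordered_mat n weighted_moment (weighted_moment i)) / Delta a b \<omega> \<beta> n"
    by (simp add: det_bordered_mat sum_divide_distrib mult.commute)
  then show ?thesis
    using det_bordered_mat_repeated_row[OF assms, of weighted_moment] by simp
qed

end

lemma interval_lebesgue_integrable_sum:
  fixes f :: "'i \<Rightarrow> real \<Rightarrow> real"
  assumes "\<And>i. i \<in> I \<Longrightarrow> interval_lebesgue_integrable M a b (f i)"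
  shows "interval_lebesgue_integrable M a b (\<lambda>y. \<Sum>i\<in>I. f i y)"
    and "interval_lebesgue_integral M a b (\<lambda>y. \<Sum>i\<in>I. f i y)
      = (\<Sum>i\<in>I. interval_lebesgue_integral M a b (f i))"
proof -
  \<comment> \<open>Both claims go through one induction, since additivity of the integral at a new
    summand needs integrability of the sum so far. For infinite \<open>I\<close> both sums are 0 by
    convention.\<close>
  have "interval_lebesgue_integrable M a b (\<lambda>y. \<Sum>i\<in>I. f i y) \<and>
    interval_lebesgue_integral M a b (\<lambda>y. \<Sum>i\<in>I. f i y)
      = (\<Sum>i\<in>I. interval_lebesgue_integral M a b (f i))"
    using assms
  proof (induction I rule: infinite_finite_induct)
    case (insert i I)
    then show ?case
      by (simp add: interval_lebesgue_integral_add)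
  qed (simp_all add: interval_lebesgue_integrable_def interval_lebesgue_integral_def
      set_integrable_def set_lebesgue_integral_def)
  then show "interval_lebesgue_integrable M a b (\<lambda>y. \<Sum>i\<in>I. f i y)"
    and "interval_lebesgue_integral M a b (\<lambda>y. \<Sum>i\<in>I. f i y)
      = (\<Sum>i\<in>I. interval_lebesgue_integral M a b (f i))"
    by blast+
qed

theorem theorem3:
  fixes a b :: ereal and \<omega> \<beta> :: "real \<Rightarrow> real"
  assumes "a < b"
    and "\<And>y. y \<in> einterval a b \<Longrightarrow> \<omega> y \<ge> 0"
    and "interval_lebesgue_integrable lebesgue a b \<omega>"
    and "(LINT y=a..b|lebesgue. \<omega> y) = 1"
    and "interval_lebesgue_integrable lebesgue a b \<beta>"
    and "\<And>j. interval_lebesgue_integrable lebesgue a b (\<lambda>y. y ^ j * \<omega> y)"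
    and "\<And>i j. interval_lebesgue_integrable lebesgue a b
            (\<lambda>y. (y ^ j * \<beta> y ^ i) * ((\<beta> y - 1) * \<omega> y))"
    and "\<And>y. y \<in> einterval a b \<Longrightarrow> \<beta> y \<noteq> 1"
    and "\<And>n. Delta a b \<omega> \<beta> n \<noteq> 0"
  shows "\<forall>n x.
    interval_lebesgue_integrable lebesgue a b
      (\<lambda>y. poly (P a b \<omega> \<beta> n) y * poly (P a b \<omega> \<beta> n) (\<beta> y * x) * \<omega> y) \<and>
    (LINT y=a..b|lebesgue. (poly (P a b \<omega> \<beta> n) y * poly (P a b \<omega> \<beta> n) (\<beta> y * x) * \<omega> y))
      = poly (P a b \<omega> \<beta> n) x"
proof (intro allI)
  fix n :: nat and x :: real
  let ?c = "P_coeff a b \<omega> \<beta> n"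
  let ?f = "\<lambda>j k y. y ^ j * \<beta> y ^ k * \<omega> y"
  let ?m = "\<lambda>j k. interval_lebesgue_integral lebesgue a b (?f j k)"
  \<comment> \<open>Writing \<open>\<beta>^(k+1) = \<beta>^k + \<beta>^k * (\<beta> - 1)\<close>
    makes the increment in \<open>k\<close> an integrand for the weight
    \<open>(\<beta> - 1) * \<omega>\<close>.\<close>
  have step: "?f j (Suc k) = (\<lambda>y. ?f j k y + (y ^ j * \<beta> y ^ k) * ((\<beta> y - 1) * \<omega> y))" for j k
    by (rule ext) (simp add: algebra_simps)
  \<comment> \<open>Integrability is assumed for \<open>k = 0\<close> and for the increments, so it
    propagates to all \<open>k\<close>.\<close>
  have int: "interval_lebesgue_integrable lebesgue a b (?f j k)" for j k
  proof (induction k)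
    case 0
    then show ?case using assms(6)[of j] by simp
  next
    case (Suc k)
    show ?case
      unfolding step by (rule interval_lebesgue_integral_add(1)[OF Suc assms(7)])
  qed
  have m_Suc: "?m j (Suc k) = ?m j k + weighted_moment a b \<omega> \<beta> k j" for j k
    unfolding step lin_fun_def by (rule interval_lebesgue_integral_add(2)[OF int assms(7)])
  \<comment> \<open>The increment from \<open>k\<close> to \<open>Suc k\<close> vanishes when
    \<open>k < n\<close>, so the value 1 at \<open>k = 0\<close> persists up to
    \<open>k = n\<close>, the largest exponent of \<beta> that the product below needs.\<close>
  have one: "(\<Sum>j\<le>n. ?c j * ?m j k) = 1" if "k \<le> n" for k
    using that
  proof (induction k)
    case 0
    then show ?case
      using P_coeff_sum_moments[OF assms(9)] by (simp add: lin_fun_def)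
  next
    case (Suc k)
    then show ?case
      unfolding m_Suc distrib_left sum.distrib
      by (simp only: P_coeff_sum_weighted_moments Suc_le_eq less_imp_le add_0_right)
  qed
  \<comment> \<open>The index \<open>k\<close> comes from the factor evaluated at
    \<open>\<beta> y * x\<close>, and \<open>j\<close> from the factor evaluated at
    \<open>y\<close>. Grouping by \<open>k\<close> leaves inside exactly the sum whose integral
    \<open>one\<close> evaluates.\<close>
  have expand: "poly (P a b \<omega> \<beta> n) y * poly (P a b \<omega> \<beta> n) (\<beta> y * x) * \<omega> y
      = (\<Sum>k\<le>n. (?c k * x ^ k) * (\<Sum>j\<le>n. ?c j * ?f j k y))" for y
    unfolding poly_P sum_distrib_right sum_distrib_left
    by (simp add: power_mult_distrib mult_ac)
  have inner: "interval_lebesgue_integrable lebesgue a b (\<lambda>y. \<Sum>j\<le>n. ?c j * ?f j k y)"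
    "(LINT y=a..b|lebesgue. (\<Sum>j\<le>n. ?c j * ?f j k y)) = (\<Sum>j\<le>n. ?c j * ?m j k)" for k
    by (simp_all only: interval_lebesgue_integrable_sum interval_lebesgue_integrable_mult_right
        interval_lebesgue_integral_mult_right int)
  have outer: "interval_lebesgue_integrable lebesgue a b
      (\<lambda>y. (?c k * x ^ k) * (\<Sum>j\<le>n. ?c j * ?f j k y))" for k
    by (intro interval_lebesgue_integrable_mult_right inner)
  have "(LINT y=a..b|lebesgue. (\<Sum>k\<le>n. (?c k * x ^ k) * (\<Sum>j\<le>n. ?c j * ?f j k y)))
      = (\<Sum>k\<le>n. (?c k * x ^ k) * (\<Sum>j\<le>n. ?c j * ?m j k))"
    by (simp only: interval_lebesgue_integrable_sum(2)[OF outer]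
        interval_lebesgue_integral_mult_right inner(2))
  also have "\<dots> = poly (P a b \<omega> \<beta> n) x"
    unfolding poly_P by (intro sum.cong) (simp_all only: one atMost_iff mult_1_right)
  finally show "interval_lebesgue_integrable lebesgue a b
      (\<lambda>y. poly (P a b \<omega> \<beta> n) y * poly (P a b \<omega> \<beta> n) (\<beta> y * x) * \<omega> y) \<and>
    (LINT y=a..b|lebesgue. (poly (P a b \<omega> \<beta> n) y * poly (P a b \<omega> \<beta> n) (\<beta> y * x) * \<omega> y))
      = poly (P a b \<omega> \<beta> n) x"
    unfolding expand by (intro conjI interval_lebesgue_integrable_sum(1) outer)
qed

end
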